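(* For every $n\ge1$, the polynomials $G_n(x)=\sum_{T\in\mathcal P_n}x^{\mathrm{oleaf}(T)}$ and $M_n(x)=\sum_{T\in\mathcal T_{n+1}}x^{\mathrm{oleaf}(T)}$ have only non-positive real zeros.
   Context: A plane tree is an unlabeled rooted tree in which the children of every vertex are linearly ordered; $\mathcal P_n$ is the set of plane trees with $n$ edges. A leaf is a vertex with no children, an interior vertex one with at least one child. A leaf is an old leaf if it is the leftmost child of its parent (including a leaf that is the only child); $\mathrm{oleaf}(T)$ is the number of old leaves of $T$. A tip-augmented plane tree is a plane tree in which the leftmost child of every interior vertex is a leaf; $\mathcal T_m$ is the set of tip-augmented plane trees with $m$ edges. *)

theory Defs
  imports Complex_Main "HOL-Library.Nonpos_Ints" "HOL-Computational_Algebra.Polynomial"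
begin

text \<open>A tree is its root together with the list, from left to right, of the subtrees
  rooted at the children of the root.\<close>

datatype plane_tree = Node (children: "plane_tree list")

definition is_leaf :: "plane_tree \<Rightarrow> bool" where
  "is_leaf t \<longleftrightarrow> children t = []"

fun edges :: "plane_tree \<Rightarrow> nat" where
  "edges (Node ts) = length ts + sum_list (map edges ts)"

text \<open>The first summand accounts for the leftmost child of the root: an old leaf is
  counted at its parent, so the one-vertex tree has no old leaf.\<close>

fun oleaf :: "plane_tree \<Rightarrow> nat" where
  "oleaf (Node ts) =
     (if ts \<noteq> [] \<and> is_leaf (hd ts) then 1 else 0) + sum_list (map oleaf ts)"

fun tip_augmented :: "plane_tree \<Rightarrow> bool" where
  "tip_augmented (Node ts) \<longleftrightarrow>
     (ts \<noteq> [] \<longrightarrow> is_leaf (hd ts)) \<and> (\<forall>t\<in>set ts. tip_augmented t)"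

definition plane_trees :: "nat \<Rightarrow> plane_tree set" where
  "plane_trees n = {T. edges T = n}"

definition tip_augmented_trees :: "nat \<Rightarrow> plane_tree set" where
  "tip_augmented_trees m = {T \<in> plane_trees m. tip_augmented T}"

lemma finite_edges_le: "finite {T. edges T \<le> n}"
proof (induction n)
  case 0
  have "{T. edges T \<le> 0} \<subseteq> {Node []}"
  proof
    fix T assume "T \<in> {T. edges T \<le> 0}"
    then show "T \<in> {Node []}" by (cases T) auto
  qed
  then show ?case by (rule finite_subset) simp
next
  case (Suc n)
  let ?L = "{ts. set ts \<subseteq> {T. edges T \<le> n} \<and> length ts \<le> Suc n}"
  have "{T. edges T \<le> Suc n} \<subseteq> Node ` ?L"
  proof
    fix T assume T: "T \<in> {T. edges T \<le> Suc n}"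
    obtain ts where ts: "T = Node ts" by (cases T)
    have len: "length ts + sum_list (map edges ts) \<le> Suc n"
      using T ts by simp
    have "edges t \<le> n" if t: "t \<in> set ts" for t
    proof -
      have "edges t \<le> sum_list (map edges ts)"
        using t by (intro member_le_sum_list) auto
      moreover have "length ts > 0" using t by (cases ts) auto
      ultimately show ?thesis using len by linarith
    qed
    then show "T \<in> Node ` ?L" using ts len by auto
  qed
  then show ?case
    by (rule finite_subset) (intro finite_imageI finite_lists_length_le Suc)
qed

lemma finite_plane_trees [simp]: "finite (plane_trees n)"
  by (rule finite_subset[OF _ finite_edges_le[of n]]) (auto simp: plane_trees_def)

lemma finite_tip_augmented_trees [simp]: "finite (tip_augmented_trees m)"
  by (simp add: tip_augmented_trees_def)

definition G :: "nat \<Rightarrow> real poly" where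
  "G n = (\<Sum>T\<in>plane_trees n. monom 1 (oleaf T))"

definition M :: "nat \<Rightarrow> real poly" where
  "M n = (\<Sum>T\<in>tip_augmented_trees (n + 1). monom 1 (oleaf T))"

text \<open>All complex zeros are real and non-positive; in particular the polynomial is not zero.\<close>

definition only_nonpos_real_zeros :: "real poly \<Rightarrow> bool" where
  "only_nonpos_real_zeros p \<longleftrightarrow>
     (\<forall>z::complex. poly (map_poly complex_of_real p) z = 0 \<longrightarrow> z \<in> \<real>\<^sub>\<le>\<^sub>0)"

end

theory Submission
  imports Defs "HOL-Analysis.Line_Segment" "HOL-Computational_Algebra.Fundamental_Theorem_Algebra"
    "HOL-Computational_Algebra.Formal_Power_Series"
begin

text \<open>Cutting off the subtree of the last child of the root shows that, at a fixed argument
  \<open>x\<close>, both \<open>p n = M n\<close> (with \<open>b = 1\<close>) and \<open>p n = G (n + 1)\<close> (with \<open>b = 2\<close>) satisfy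
  \<open>p 0 = x\<close> and \<open>p (n + 1) = b p n + (\<Sum>i<n. p i p (n - 1 - i))\<close>. Solving the quadratic equation for
  the generating function by means of Catalan numbers gives the instance
  \<open>(n + 1) p n = [s^n] (x + b s + s^2)^(n + 1)\<close> of Lagrange inversion.

  Replacing \<open>(x, b)\<close> by \<open>(l^2 x, l b)\<close> multiplies \<open>p n\<close> by \<open>l^(n + 2)\<close>. If \<open>x\<close> is not \<open>b^2 / 4\<close>, then
  \<open>l\<close> can be chosen such that \<open>(l^2 x, l b) = (c^2 - 1, 2 c)\<close>; the quadratic polynomial then is
  \<open>(c + s)^2 - 1\<close>, so the coefficient is, up to a factorial, the \<open>n\<close>-th derivative of
  \<open>(X^2 - 1)^(n + 1)\<close> at \<open>c\<close>. By the Gauss-Lucas theorem, \<open>p n = 0\<close> forces \<open>c\<close> to lie in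
  \<open>[-1, 1]\<close>, whence \<open>x = (c^2 - 1) / l^2\<close> is real and non-positive. In the
  exceptional case \<open>x = b^2 / 4\<close> all \<open>p n\<close> are positive.\<close>

section \<open>The Gauss-Lucas theorem\<close>

text \<open>At a zero of \<open>pderiv p\<close> that is not a zero of \<open>p\<close>, the
  logarithmic derivative shows that the sum of the \<open>1 / (z - r i)\<close> vanishes.
  Conjugation turns each summand into a positive multiple of \<open>z - r i\<close>, so
  \<open>z\<close> is a convex combination of the roots.\<close>

theorem gauss_lucas:
  fixes p :: "complex poly"
  assumes "convex S" and deg: "degree p > 0" and roots: "\<And>a. poly p a = 0 \<Longrightarrow> a \<in> S"
    and z: "poly (pderiv p) z = 0"
  shows "z \<in> S"
proof (cases "poly p z = 0")
  case True
  then show ?thesis by (rule roots)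
next
  case False
  define n where "n = degree p"
  obtain r where r: "smult (lead_coeff p) (\<Prod>i<n. [:- r i, 1:]) = p"
    unfolding n_def by (rule complex_poly_decompose')
  have pz: "poly p w = lead_coeff p * (\<Prod>i<n. w - r i)" for w
    by (subst r [symmetric]) (simp add: poly_prod)
  have nz: "z - r i \<noteq> 0" if "i < n" for i
    using False that by (auto simp: pz)
  have r_S: "r i \<in> S" if "i < n" for i
    using that by (intro roots) (auto simp: pz)
  have "poly (pderiv p) z = lead_coeff p * (\<Sum>i<n. \<Prod>j\<in>{..<n} - {i}. z - r j)"
    by (subst r [symmetric])
       (simp add: pderiv_smult pderiv_prod poly_sum poly_prod pderiv_pCons)
  also have "(\<Sum>i<n. \<Prod>j\<in>{..<n} - {i}. z - r j) = (\<Prod>i<n. z - r i) * (\<Sum>i<n. 1 / (z - r i))"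
    unfolding sum_distrib_left
  proof (rule sum.cong)
    fix i assume "i \<in> {..<n}"
    then show "(\<Prod>j\<in>{..<n} - {i}. z - r j) = (\<Prod>i<n. z - r i) * (1 / (z - r i))"
      using nz[of i] by (subst prod.remove[of _ i]) auto
  qed simp
  finally have "(\<Sum>i<n. 1 / (z - r i)) = 0"
    using z False by (auto simp: pz)
  then have "cnj (\<Sum>i<n. 1 / (z - r i)) = 0" by simp
  define w where "w i = 1 / (cmod (z - r i))\<^sup>2" for i
  define W where "W = (\<Sum>i<n. w i)"
  have w_pos: "w i > 0" if "i < n" for i
    using nz[OF that] by (simp add: w_def)
  have "W > 0"
    unfolding W_def using deg w_pos by (intro sum_pos) (auto simp: n_def)
  have "cnj (1 / (z - r i)) = w i *\<^sub>R (z - r i)" for i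
  proof -
    have "cnj (1 / a) = (1 / (cmod a)\<^sup>2) *\<^sub>R a" for a
      by (cases "a = 0") (auto simp: scaleR_conv_of_real complex_norm_square field_simps simp del: of_real_power)
    then show ?thesis by (simp only: w_def)
  qed
  then have "(\<Sum>i<n. w i *\<^sub>R (z - r i)) = 0"
    using \<open>cnj (\<Sum>i<n. 1 / (z - r i)) = 0\<close> by (simp only: cnj_sum)
  then have "W *\<^sub>R z = (\<Sum>i<n. w i *\<^sub>R r i)"
    by (simp add: W_def scaleR_sum_left scaleR_diff_right sum_subtractf)
  then have "z = (1 / W) *\<^sub>R (\<Sum>i<n. w i *\<^sub>R r i)"
    using \<open>W > 0\<close> by (metis divide_self_if less_irrefl one_neq_zero scaleR_one scaleR_scaleR times_divide_eq_left mult_1)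
  also have "\<dots> = (\<Sum>i<n. (w i / W) *\<^sub>R r i)"
    by (simp add: scaleR_sum_right)
  also have "\<dots> \<in> S"
  proof (rule convex_sum)
    show "(\<Sum>i<n. w i / W) = 1"
      using \<open>W > 0\<close> by (simp add: W_def flip: sum_divide_distrib)
  qed (use assms(1) w_pos \<open>W > 0\<close> r_S in \<open>auto intro: less_imp_le\<close>)
  finally show ?thesis .
qed

text \<open>Each differentiation keeps the zeros in \<open>S\<close>; \<open>k < degree p\<close>
  ensures that every polynomial being differentiated is nonconstant.\<close>

corollary gauss_lucas_higher:
  fixes p :: "complex poly"
  assumes "convex S" and "k < degree p" and "\<And>a. poly p a = 0 \<Longrightarrow> a \<in> S"
    and "poly ((pderiv ^^ k) p) z = 0"
  shows "z \<in> S"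
  using assms(2,4)
proof (induction k arbitrary: z)
  case 0
  then show ?case using assms(3) by simp
next
  case (Suc k)
  show ?case
  proof (rule gauss_lucas[OF assms(1)])
    show "degree ((pderiv ^^ k) p) > 0"
      using Suc.prems by (simp add: degree_higher_pderiv)
    show "poly (pderiv ((pderiv ^^ k) p)) z = 0"
      using Suc.prems by simp
  qed (use Suc in simp)
qed

section \<open>Taylor coefficients and the zeros of a coefficient polynomial\<close>

lemma higher_pderiv_pcompose_shift:
  fixes p :: "'a :: idom poly"
  shows "(pderiv ^^ k) (pcompose p [:c, 1:]) = pcompose ((pderiv ^^ k) p) [:c, 1:]"
  by (induction k) (simp_all add: pderiv_pcompose pderiv_pCons)

lemma fact_mult_coeff_shift:
  fixes p :: "'a :: {idom, semiring_char_0} poly"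
  shows "fact k * coeff (pcompose p [:c, 1:]) k = poly ((pderiv ^^ k) p) c"
proof -
  have "fact k * coeff (pcompose p [:c, 1:]) k = coeff ((pderiv ^^ k) (pcompose p [:c, 1:])) 0"
    by (simp add: coeff_higher_pderiv pochhammer_fact)
  also have "\<dots> = poly (pcompose ((pderiv ^^ k) p) [:c, 1:]) 0"
    by (simp only: higher_pderiv_pcompose_shift poly_0_coeff_0)
  finally show ?thesis by (simp add: poly_pcompose)
qed

lemma root_coeff_quadratic_power:
  fixes c :: complex
  assumes "coeff ([:c\<^sup>2 - 1, 2 * c, 1:] ^ Suc n) n = 0"
  shows "\<exists>t. c = of_real t \<and> t\<^sup>2 \<le> 1"
proof -
  let ?p = "[:-1, 0, 1:] :: complex poly"
  have "pcompose (?p ^ Suc n) [:c, 1:] = [:c\<^sup>2 - 1, 2 * c, 1:] ^ Suc n"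
    by (intro poly_eq_poly_eq_iff[THEN iffD1] ext)
       (simp add: poly_pcompose algebra_simps power2_eq_square)
  then have "poly ((pderiv ^^ n) (?p ^ Suc n)) c = 0"
    using assms fact_mult_coeff_shift[of n "?p ^ Suc n" c] by simp
  then have "c \<in> closed_segment (-1) 1"
  proof (rule gauss_lucas_higher[rotated 3])
    show "n < degree (?p ^ Suc n)"
      by (subst degree_power_eq) auto
  next
    fix a assume "poly (?p ^ Suc n) a = 0"
    then have "a\<^sup>2 = 1"
      by (auto simp: power2_eq_square)
    then show "a \<in> closed_segment (-1) 1"
      by (auto simp: power2_eq_1_iff)
  qed simp
  then obtain u where u: "0 \<le> u" "u \<le> 1" "c = (1 - u) *\<^sub>R (-1) + u *\<^sub>R 1"
    by (auto simp: in_segment)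
  then have "c = of_real (2 * u - 1)"
    by (simp add: scaleR_conv_of_real)
  moreover have "(2 * u - 1)\<^sup>2 \<le> 1"
    using u by (auto simp: abs_le_square_iff[of _ 1, simplified, symmetric])
  ultimately show ?thesis by blast
qed

section \<open>Catalan numbers\<close>

unbundle no vec_syntax
unbundle fps_syntax

text \<open>The value lies in a field, so the quotient is exact and integrality never has to be
  proved.\<close>

definition catalan_number :: "nat \<Rightarrow> 'a :: field_char_0" where
  "catalan_number n = of_nat ((2 * n) choose n) / of_nat (Suc n)"

lemma catalan_number_0 [simp]: "catalan_number 0 = 1"
  by (simp add: catalan_number_def)

lemma catalan_number_eq_fact:
  "catalan_number n = (fact (2 * n) / (fact n * fact (Suc n)) :: 'a :: field_char_0)"
  by (simp add: catalan_number_def binomial_fact field_simps mult_2)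

lemma catalan_number_Suc:
  "catalan_number (Suc n) = 2 * of_nat (2 * n + 1) / of_nat (n + 2) * (catalan_number n :: 'a :: field_char_0)"
proof -
  have nz: "(of_nat n + 1 :: 'a) \<noteq> 0" "(of_nat n + 2 :: 'a) \<noteq> 0"
    using of_nat_neq_0[of n, where 'a='a] of_nat_neq_0[of "Suc n", where 'a='a]
    by (simp_all add: add.commute)
  show ?thesis
    unfolding catalan_number_eq_fact using nz
    by (simp add: divide_simps) (simp add: algebra_simps)
qed

text \<open>These are the coefficients of \<open>sqrt (1 - 4 X) = 1 - 2 X C\<close>, with
  \<open>C\<close> the Catalan series. Consecutive terms on both sides have the ratio
  \<open>2 (2 n + 1) / (n + 2)\<close>.\<close>

lemma gbinomial_half_Suc:
  "((1 / 2) gchoose Suc n) * (- 4) ^ Suc n = (- 2 * catalan_number n :: 'a :: field_char_0)"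
proof (induction n)
  case (Suc n)
  have nz: "(of_nat n + 1 :: 'a) \<noteq> 0" "(of_nat n + 2 :: 'a) \<noteq> 0"
    using of_nat_neq_0[of n, where 'a='a] of_nat_neq_0[of "Suc n", where 'a='a]
    by (simp_all add: add.commute)
  have "(a gchoose Suc k) * of_nat (Suc k) = (a gchoose k) * (a - of_nat k)" for a :: 'a and k
    using gbinomial_mult_1[of a k] by (simp add: algebra_simps)
  from this[of "1 / 2" "Suc n"]
  have "((1 / 2 :: 'a) gchoose Suc (Suc n)) = ((1 / 2) gchoose Suc n) * (1 / 2 - of_nat (Suc n)) / of_nat (Suc (Suc n))"
    by (intro eq_divide_imp of_nat_neq_0)
  then have "((1 / 2 :: 'a) gchoose Suc (Suc n)) * (- 4) ^ Suc (Suc n) =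
      (((1 / 2) gchoose Suc n) * (- 4) ^ Suc n) * (- 4 * (1 / 2 - of_nat (Suc n))) / of_nat (Suc (Suc n))"
    by (simp only: power_Suc[of _ "Suc n"] times_divide_eq_left times_divide_eq_right mult_ac)
  also have "\<dots> = - 2 * catalan_number (Suc n)"
    using nz unfolding Suc.IH catalan_number_Suc by (simp add: divide_simps)
  finally show ?case .
qed simp

text \<open>Squaring \<open>sqrt (1 - 4 X)\<close> gives a polynomial of degree 1, whose coefficient
  at \<open>n + 2\<close> is zero. In that coefficient the two end terms yield
  \<open>catalan_number (Suc n)\<close> and the inner ones the convolution.\<close>

lemma catalan_number_convolution:
  "catalan_number (Suc n) = (\<Sum>i\<le>n. catalan_number i * catalan_number (n - i) :: 'a :: field_char_0)"
proof -
  define e :: "nat \<Rightarrow> 'a" where "e k = ((1 / 2) gchoose k) * (- 4) ^ k" for k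
  have e_Suc: "e (Suc k) = - 2 * catalan_number k" for k
    unfolding e_def by (rule gbinomial_half_Suc)
  have "(\<Sum>k\<le>n + 2. e k * e (n + 2 - k)) =
      (\<Sum>k=0..n + 2. ((1 / 2 :: 'a) gchoose k) * ((1 / 2) gchoose (n + 2 - k))) * (- 4) ^ (n + 2)"
    unfolding sum_distrib_right atMost_atLeast0
    by (rule sum.cong) (auto simp: e_def mult_ac simp flip: power_add)
  also have "\<dots> = 0"
    \<comment> \<open>The upper arguments add up to 1, and \<open>1 gchoose (n + 2)\<close> is
      zero.\<close>
    unfolding gbinomial_Vandermonde
    using gbinomial_of_nat_symmetric[of 1] by (simp flip: binomial_gbinomial[of 1, simplified])
  finally have "(\<Sum>k\<le>Suc (Suc n). e k * e (Suc (Suc n) - k)) = 0" by simp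
  moreover have "(\<Sum>k\<le>Suc (Suc n). e k * e (Suc (Suc n) - k)) =
      e 0 * e (Suc (Suc n)) + (\<Sum>k\<le>n. e (Suc k) * e (Suc n - k)) + e (Suc (Suc n)) * e 0"
    by (subst sum.atMost_Suc_shift, subst sum.atMost_Suc) simp
  moreover have "e 0 = 1" by (simp add: e_def)
  ultimately have "2 * e (Suc (Suc n)) + (\<Sum>k\<le>n. e (Suc k) * e (Suc n - k)) = 0"
    by simp
  moreover have "(\<Sum>k\<le>n. e (Suc k) * e (Suc n - k)) = 4 * (\<Sum>i\<le>n. catalan_number i * catalan_number (n - i))"
    unfolding sum_distrib_left by (rule sum.cong) (auto simp: e_Suc Suc_diff_le)
  ultimately show ?thesis
    by (simp add: e_Suc)
qed

definition catalan_fps :: "'a :: field_char_0 fps" where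
  "catalan_fps = Abs_fps catalan_number"

lemma fps_nth_catalan_fps [simp]: "catalan_fps $ n = catalan_number n"
  by (simp add: catalan_fps_def)

lemma catalan_fps_eq: "(catalan_fps :: 'a :: field_char_0 fps) = 1 + fps_X * catalan_fps\<^sup>2"
proof (rule fps_ext)
  fix n show "(catalan_fps :: 'a fps) $ n = (1 + fps_X * catalan_fps\<^sup>2) $ n"
    by (cases n) (simp_all add: fps_mult_nth[of "catalan_fps :: 'a fps"] power2_eq_square
        catalan_number_convolution atMost_atLeast0)
qed

section \<open>The quadratic convolution recurrence\<close>

lemma fps_nth_mult_compose:
  fixes a :: "'a :: comm_ring_1 fps"
  assumes "u $ 0 = 0"
  shows "(r * (a oo u)) $ n = (\<Sum>i\<le>n. a $ i * (r * u ^ i) $ n)"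
proof -
  \<comment> \<open>Since \<open>u ^ i\<close> has no terms below degree \<open>i\<close>, the upper
    limit can be raised to \<open>n\<close> for all \<open>m\<close>, which permits swapping the two
    sums below.\<close>
  have "(a oo u) $ m = (\<Sum>i\<le>n. a $ i * u ^ i $ m)" if "m \<le> n" for m
    unfolding fps_compose_nth
  proof (rule sum.mono_neutral_left)
    show "\<forall>i\<in>{..n} - {0..m}. a $ i * u ^ i $ m = 0"
      using startsby_zero_power_prefix[OF assms] by simp
  qed (use that in auto)
  then have "(r * (a oo u)) $ n = (\<Sum>j=0..n. r $ j * (\<Sum>i\<le>n. a $ i * u ^ i $ (n - j)))"
    by (simp add: fps_mult_nth)
  also have "\<dots> = (\<Sum>j=0..n. \<Sum>i\<le>n. a $ i * (r $ j * u ^ i $ (n - j)))"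
    by (simp add: sum_distrib_left mult_ac)
  also have "\<dots> = (\<Sum>i\<le>n. \<Sum>j=0..n. a $ i * (r $ j * u ^ i $ (n - j)))"
    by (rule sum.swap)
  finally show ?thesis
    by (simp add: fps_mult_nth sum_distrib_left)
qed

lemma fps_nth_inverse_linear_power:
  fixes b :: "'a :: field_char_0"
  shows "(inverse (1 - fps_const b * fps_X) ^ Suc k) $ m = of_nat ((m + k) choose k) * b ^ m"
proof -
  have "inverse (1 - fps_const b * fps_X) ^ Suc k = fps_binomial (- of_nat (Suc k)) oo (- fps_const b * fps_X)"
    by (simp only: fps_inverse_power [symmetric] one_minus_fps_X_const_neg_power)
  then have "(inverse (1 - fps_const b * fps_X) ^ Suc k) $ m = (- b) ^ m * ((- of_nat (Suc k)) gchoose m)"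
    by (metis fps_binomial_nth fps_const_neg fps_nth_compose_linear)
  also have "(- of_nat (Suc k) :: 'a) gchoose m = (- 1) ^ m * of_nat ((m + k) choose m)"
    by (subst gbinomial_minus) (simp add: binomial_gbinomial add_ac)
  also have "(m + k) choose m = (m + k) choose k"
    using binomial_symmetric[of m "m + k"] by simp
  finally show ?thesis
    by (cases "even m") simp_all
qed

text \<open>The functional equation determines the coefficients of \<open>Q\<close> one after
  another, by the recurrence that defines \<open>p\<close>.\<close>

lemma quadratic_recurrence_fps:
  fixes p :: "nat \<Rightarrow> 'a :: field_char_0"
  assumes p_0: "p 0 = x" and p_Suc: "\<And>n. p (Suc n) = b * p n + (\<Sum>i<n. p i * p (n - 1 - i))"
    and Q: "Q * (1 - fps_const b * fps_X) = fps_const x + (fps_X * Q)\<^sup>2"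
  shows "p n = Q $ n"
proof (induction n rule: less_induct)
  case (less n)
  have Q': "Q = fps_const x + fps_X * (fps_const b * Q + fps_X * (Q * Q))"
    using Q by (simp add: algebra_simps power2_eq_square)
  have Q_nth: "Q $ m = (if m = 0 then x else b * Q $ (m - 1) + (fps_X * (Q * Q)) $ (m - 1))" for m
    by (subst Q') simp
  show ?case
  proof (cases n)
    case 0
    then show ?thesis using Q_nth[of 0] by (simp add: p_0)
  next
    case (Suc m)
    have "(fps_X * (Q * Q)) $ m = (\<Sum>i<m. Q $ i * Q $ (m - 1 - i))"
      by (cases m) (simp_all add: fps_mult_nth[of Q] lessThan_Suc_atMost atMost_atLeast0)
    also have "\<dots> = (\<Sum>i<m. p i * p (m - 1 - i))"
      by (rule sum.cong) (auto simp: less Suc)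
    finally show ?thesis
      using Q_nth[of "Suc m"] less[of m] by (simp add: Suc p_Suc)
  qed
qed

text \<open>With \<open>R = 1 / (1 - b X)\<close> and \<open>u = x X^2 R^2\<close>, the substitution
  \<open>Q = x R K\<close> reduces the quadratic equation for \<open>Q\<close> to the Catalan
  equation \<open>K = 1 + u K^2\<close>. Hence \<open>K\<close> is the Catalan series at
  \<open>u\<close>, and the powers of \<open>R\<close> expand by the negative binomial
  series.\<close>

lemma quadratic_recurrence_closed_form:
  fixes p :: "nat \<Rightarrow> 'a :: field_char_0"
  assumes "p 0 = x" and "\<And>n. p (Suc n) = b * p n + (\<Sum>i<n. p i * p (n - 1 - i))"
  shows "p n = (\<Sum>j\<le>n div 2. catalan_number j * of_nat (n choose (2 * j)) * b ^ (n - 2 * j) * x ^ Suc j)"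
proof -
  define R where "R = inverse (1 - fps_const b * fps_X)"
  define u where "u = fps_const x * (fps_X * R)\<^sup>2"
  define K where "K = catalan_fps oo u"
  have u_0: "u $ 0 = 0"
    by (simp add: u_def)
  have K: "K = 1 + u * K\<^sup>2"
    unfolding K_def using u_0
    by (subst catalan_fps_eq) (simp add: fps_compose_add_distrib fps_compose_mult_distrib power2_eq_square)
  have R: "R * (1 - fps_const b * fps_X) = 1"
    unfolding R_def by (rule inverse_mult_eq_1) simp
  let ?Q = "fps_const x * R * K"
  have "?Q * (1 - fps_const b * fps_X) = fps_const x * K * (R * (1 - fps_const b * fps_X))"
    by (simp only: mult_ac)
  also have "\<dots> = fps_const x * K"
    by (simp only: R mult_1_right)
  also have "\<dots> = fps_const x * (1 + u * K\<^sup>2)"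
    by (simp only: flip: K)
  also have "\<dots> = fps_const x + (fps_X * ?Q)\<^sup>2"
    by (simp add: u_def algebra_simps power2_eq_square)
  finally have "p n = ?Q $ n"
    using quadratic_recurrence_fps[of p, OF assms] by blast
  also have "\<dots> = (\<Sum>i\<le>n. catalan_number i * (fps_const x * R * u ^ i) $ n)"
    unfolding K_def by (subst fps_nth_mult_compose[OF u_0]) simp
  also have "\<dots> = (\<Sum>i\<le>n. if i \<in> {..n div 2}
      then catalan_number i * of_nat (n choose (2 * i)) * b ^ (n - 2 * i) * x ^ Suc i else 0)"
  proof (rule sum.cong)
    fix i
    have "fps_const x * R * u ^ i = fps_const (x ^ Suc i) * (fps_X ^ (2 * i) * R ^ Suc (2 * i))"
      by (simp add: u_def power_mult_distrib fps_const_power mult_ac flip: power_mult fps_const_mult)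
    then have "(fps_const x * R * u ^ i) $ n = x ^ Suc i * (if n < 2 * i then 0 else (R ^ Suc (2 * i)) $ (n - 2 * i))"
      by (simp add: fps_X_power_mult_nth del: power_Suc)
    then show "catalan_number i * (fps_const x * R * u ^ i) $ n =
        (if i \<in> {..n div 2} then catalan_number i * of_nat (n choose (2 * i)) * b ^ (n - 2 * i) * x ^ Suc i else 0)"
      by (auto simp: R_def fps_nth_inverse_linear_power simp del: power_Suc)
  qed simp
  also have "\<dots> = (\<Sum>i\<in>{..n} \<inter> {..n div 2}. catalan_number i * of_nat (n choose (2 * i)) * b ^ (n - 2 * i) * x ^ Suc i)"
    by (rule sum.inter_restrict [symmetric]) simp
  also have "{..n} \<inter> {..n div 2} = {..n div 2}"
    by auto
  finally show ?thesis .
qed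

text \<open>Both sides equal \<open>(n + 1)! / (j! (j + 1)! (n - 2 j)!)\<close>.\<close>

lemma binomial_product_catalan:
  assumes "2 * j \<le> n"
  shows "of_nat (Suc n choose Suc j) * of_nat ((n - j) choose j) =
    of_nat (Suc n) * catalan_number j * (of_nat (n choose (2 * j)) :: 'a :: field_char_0)"
proof -
  have "of_nat (Suc n choose Suc j) = (fact (Suc n) / (fact (Suc j) * fact (n - j)) :: 'a)"
    using assms by (subst binomial_fact) auto
  moreover have "of_nat ((n - j) choose j) = (fact (n - j) / (fact j * fact (n - 2 * j)) :: 'a)"
    using assms by (subst binomial_fact) (auto simp: mult_2)
  moreover have "of_nat (n choose (2 * j)) = (fact n / (fact (2 * j) * fact (n - 2 * j)) :: 'a)"
    using assms by (rule binomial_fact)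
  moreover have "fact (Suc n) = (of_nat (Suc n) * fact n :: 'a)"
    by (rule fact_Suc)
  ultimately show ?thesis
    unfolding catalan_number_eq_fact by (simp del: fact_Suc of_nat_Suc)
qed

text \<open>Expand \<open>(x + s (b + s))^(n + 1)\<close>: choosing \<open>x\<close> from
  \<open>j + 1\<close> factors leaves \<open>s^(n - j) (b + s)^(n - j)\<close>, from which
  \<open>s^n\<close> is taken with coefficient
  \<open>((n - j) choose j) b^(n - 2 j)\<close>.\<close>

lemma coeff_quadratic_power:
  fixes x b :: "'a :: field_char_0"
  shows "coeff ([:x, b, 1:] ^ Suc n) n =
    of_nat (Suc n) * (\<Sum>j\<le>n div 2. catalan_number j * of_nat (n choose (2 * j)) * b ^ (n - 2 * j) * x ^ Suc j)"
proof -
  define L where "L = [:b, 1:]"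
  have quadratic: "[:x, b, 1:] = [:x:] + monom 1 1 * L"
    by (simp add: L_def monom_altdef)
  have term_coeff: "coeff (of_nat m * [:x:] ^ k * (monom 1 1 * L) ^ i) n =
      of_nat m * x ^ k * (if n < i then 0 else coeff (L ^ i) (n - i))" for m k i
  proof -
    have "of_nat m * [:x:] ^ k = [:of_nat m * x ^ k:]"
      by (simp add: of_nat_poly poly_const_pow)
    moreover have "(monom 1 1 * L) ^ i = monom 1 i * L ^ i"
      by (simp only: power_mult_distrib monom_power power_one mult_1)
    ultimately show ?thesis
      by (simp only: coeff_monom_mult mult_1 mult_pCons_left coeff_add coeff_smult) (simp add: coeff_pCons split: nat.split)
  qed
  have "coeff ([:x, b, 1:] ^ Suc n) n =
      (\<Sum>k\<le>Suc n. coeff (of_nat (Suc n choose k) * [:x:] ^ k * (monom 1 1 * L) ^ (Suc n - k)) n)"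
    unfolding quadratic by (simp only: binomial_ring coeff_sum)
  also have "\<dots> = (\<Sum>k\<le>Suc n. of_nat (Suc n choose k) * x ^ k *
      (if n < Suc n - k then 0 else coeff (L ^ (Suc n - k)) (n - (Suc n - k))))"
    by (simp only: term_coeff)
  \<comment> \<open>The term \<open>k = 0\<close> is divisible by \<open>s^(n + 1)\<close> and drops
    out; the others are reindexed by \<open>k = Suc j\<close>.\<close>
  also have "\<dots> = (\<Sum>j\<le>n. of_nat (Suc n choose Suc j) * x ^ Suc j * coeff (L ^ (n - j)) j)"
    by (subst sum.atMost_Suc_shift) (auto simp del: binomial_Suc_Suc power_Suc intro!: sum.cong)
  also have "\<dots> = (\<Sum>j\<le>n. if j \<in> {..n div 2} then
      of_nat (Suc n) * (catalan_number j * of_nat (n choose (2 * j)) * b ^ (n - 2 * j) * x ^ Suc j) else 0)"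
  proof (rule sum.cong)
    fix j assume "j \<in> {..n}"
    show "of_nat (Suc n choose Suc j) * x ^ Suc j * coeff (L ^ (n - j)) j =
      (if j \<in> {..n div 2} then
      of_nat (Suc n) * (catalan_number j * of_nat (n choose (2 * j)) * b ^ (n - 2 * j) * x ^ Suc j) else 0)"
    proof (cases "j \<le> n div 2")
      case True
      then have "coeff (L ^ (n - j)) j = of_nat ((n - j) choose j) * b ^ (n - 2 * j)"
        unfolding L_def by (subst coeff_linear_poly_power) (auto simp: mult_2)
      then show ?thesis
        using True binomial_product_catalan[of j n, where 'a='a]
        by (simp del: binomial_Suc_Suc power_Suc of_nat_Suc)
    next
      case False
      have "degree (L ^ (n - j)) = n - j"
        unfolding L_def by (subst degree_power_eq) auto
      then have "coeff (L ^ (n - j)) j = 0"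
        using False by (intro coeff_eq_0) auto
      then show ?thesis using False by simp
    qed
  qed simp
  also have "\<dots> = (\<Sum>j\<in>{..n} \<inter> {..n div 2}. of_nat (Suc n) * (catalan_number j * of_nat (n choose (2 * j)) * b ^ (n - 2 * j) * x ^ Suc j))"
    by (rule sum.inter_restrict [symmetric]) simp
  also have "{..n} \<inter> {..n div 2} = {..n div 2}"
    by auto
  finally show ?thesis by (simp only: sum_distrib_left)
qed

text \<open>Lagrange inversion for \<open>F = s (x + b F + F^2)\<close>, where
  \<open>F = s Q\<close> and \<open>Q\<close> is the generating function of \<open>p\<close>; here
  it follows by comparing closed forms.\<close>

lemma quadratic_recurrence_coeff:
  fixes p :: "nat \<Rightarrow> 'a :: field_char_0"
  assumes "p 0 = x" and "\<And>n. p (Suc n) = b * p n + (\<Sum>i<n. p i * p (n - 1 - i))"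
  shows "of_nat (Suc n) * p n = coeff ([:x, b, 1:] ^ Suc n) n"
  unfolding coeff_quadratic_power quadratic_recurrence_closed_form[of p, OF assms] ..

text \<open>The offset 2 in the exponent makes the recurrence homogeneous:
  \<open>(i + 2) + (n - 1 - i + 2) = n + 3\<close> for every product in the sum.\<close>

lemma quadratic_recurrence_scale:
  fixes p :: "nat \<Rightarrow> 'a :: comm_ring_1" and l :: 'a
  assumes "p (Suc n) = b * p n + (\<Sum>i<n. p i * p (n - 1 - i))"
  defines "q \<equiv> \<lambda>n. l ^ (n + 2) * p n"
  shows "q (Suc n) = l * b * q n + (\<Sum>i<n. q i * q (n - 1 - i))"
proof -
  have "q i * q (n - 1 - i) = l ^ (n + 3) * (p i * p (n - 1 - i))" if "i < n" for i
  proof -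
    have "n + 3 = (i + 2) + (n - 1 - i + 2)" using that by simp
    then show ?thesis unfolding q_def by (simp only: power_add mult_ac)
  qed
  then have "(\<Sum>i<n. q i * q (n - 1 - i)) = l ^ (n + 3) * (\<Sum>i<n. p i * p (n - 1 - i))"
    by (simp add: sum_distrib_left)
  then show ?thesis
    unfolding q_def by (simp add: assms(1) algebra_simps power_add eval_nat_numeral)
qed

text \<open>This excludes a zero in the case \<open>x = b^2 / 4\<close>, where no scaling to
  \<open>(c^2 - 1, 2 c)\<close> exists.\<close>

lemma quadratic_recurrence_pos:
  fixes p :: "nat \<Rightarrow> complex"
  assumes "p 0 = of_real x" and "\<And>n. p (Suc n) = of_real b * p n + (\<Sum>i<n. p i * p (n - 1 - i))"
    and "x > 0" "b > 0"
  shows "\<exists>y>0. p n = of_real y"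
proof (induction n rule: less_induct)
  case (less n)
  then obtain y where y: "\<And>m. m < n \<Longrightarrow> y m > 0 \<and> p m = of_real (y m)"
    by metis
  show ?case
  proof (cases n)
    case 0
    then show ?thesis using assms by auto
  next
    case (Suc m)
    have "(\<Sum>i<m. p i * p (m - 1 - i)) = of_real (\<Sum>i<m. y i * y (m - 1 - i))"
      unfolding of_real_sum by (rule sum.cong) (auto simp: y Suc)
    then have "p n = of_real (b * y m + (\<Sum>i<m. y i * y (m - 1 - i)))"
      by (simp add: Suc assms(2) y)
    moreover have "b * y m + (\<Sum>i<m. y i * y (m - 1 - i)) > 0"
      using y Suc \<open>b > 0\<close> by (intro add_pos_nonneg sum_nonneg mult_pos_pos mult_nonneg_nonneg) (auto intro: less_imp_le)
    ultimately show ?thesis by blast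
  qed
qed

lemma quadratic_recurrence_zero_nonpos:
  fixes p :: "nat \<Rightarrow> complex" and b :: real
  assumes p_0: "p 0 = x" and p_Suc: "\<And>n. p (Suc n) = of_real b * p n + (\<Sum>i<n. p i * p (n - 1 - i))"
    and b: "b > 0" and zero: "p n = 0"
  shows "x \<in> \<real>\<^sub>\<le>\<^sub>0"
proof -
  define d where "d = of_real (b\<^sup>2 / 4) - x"
  have "d \<noteq> 0"
  proof
    assume "d = 0"
    then have "p 0 = of_real (b\<^sup>2 / 4)" by (simp add: d_def p_0)
    then show False
      using quadratic_recurrence_pos[of p "b\<^sup>2 / 4" b n] p_Suc b zero by auto
  qed
  \<comment> \<open>\<open>d\<close> is a quarter of the discriminant of
    \<open>s^2 + b s + x\<close>; this \<open>l\<close> scales it to 1, which is the identity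
    \<open>c^2 - l^2 x = 1\<close>.\<close>
  define l where "l = csqrt (1 / d)"
  have l: "l\<^sup>2 * d = 1"
    using \<open>d \<noteq> 0\<close> by (simp add: l_def)
  define c where "c = l * of_real b / 2"
  have lx: "l\<^sup>2 * x = c\<^sup>2 - 1"
    using l by (simp add: c_def d_def power_mult_distrib power_divide algebra_simps)
  define q where "q n = l ^ (n + 2) * p n" for n
  have "of_nat (Suc n) * q n = coeff ([:c\<^sup>2 - 1, 2 * c, 1:] ^ Suc n) n"
  proof (rule quadratic_recurrence_coeff)
    show "q 0 = c\<^sup>2 - 1"
      using lx by (simp add: q_def p_0 power2_eq_square)
    show "q (Suc m) = 2 * c * q m + (\<Sum>i<m. q i * q (m - 1 - i))" for m
      using quadratic_recurrence_scale[OF p_Suc, of l m] by (simp add: q_def c_def)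
  qed
  then have "coeff ([:c\<^sup>2 - 1, 2 * c, 1:] ^ Suc n) n = 0"
    by (simp add: q_def zero)
  then obtain t where t: "c = of_real t" "t\<^sup>2 \<le> 1"
    using root_coeff_quadratic_power by blast
  \<comment> \<open>As \<open>b\<close> is real and nonzero, \<open>c = l b / 2\<close> being real
    makes \<open>l\<close> real, so \<open>l^2\<close> is a positive real number.\<close>
  define s where "s = 2 * t / b"
  have ls: "l = of_real s"
    using b t by (simp add: s_def c_def field_simps)
  have "s \<noteq> 0"
    using l ls by auto
  then have "x = of_real ((t\<^sup>2 - 1) / s\<^sup>2)"
    using lx by (simp add: ls t field_simps)
  also have "\<dots> \<in> \<real>\<^sub>\<le>\<^sub>0"
    using t by (simp only: complex_nonpos_Reals_iff) (auto simp: divide_nonpos_nonneg simp flip: of_real_power of_real_diff of_real_divide)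
  finally show ?thesis .
qed

section \<open>Counting plane trees by old leaves\<close>

text \<open>Attaching \<open>t\<close> as the last child keeps the leftmost child of the root unless
  the root had none; then \<open>t\<close> itself becomes leftmost. This is the only exceptional
  case for \<open>oleaf\<close> and \<open>tip_augmented\<close>.\<close>

fun graft :: "plane_tree \<Rightarrow> plane_tree \<Rightarrow> plane_tree" where
  "graft (Node ts) t = Node (ts @ [t])"

lemma edges_graft [simp]: "edges (graft T t) = Suc (edges T + edges t)"
  by (cases T) simp

lemma is_leaf_iff_edges: "is_leaf T \<longleftrightarrow> edges T = 0"
  by (cases T) (auto simp: is_leaf_def)

lemma oleaf_graft:
  "oleaf (graft T t) = oleaf T + oleaf t + (if is_leaf T \<and> is_leaf t then 1 else 0)"
  by (cases T) (auto simp: is_leaf_def hd_append)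

lemma tip_augmented_graft:
  "tip_augmented (graft T t) \<longleftrightarrow> tip_augmented T \<and> tip_augmented t \<and> (is_leaf T \<longrightarrow> is_leaf t)"
  by (cases T) (auto simp: is_leaf_def hd_append)

lemma graft_inject: "graft T t = graft T' t' \<longleftrightarrow> T = T' \<and> t = t'"
  by (cases T; cases T') auto

lemma plane_trees_0: "plane_trees 0 = {Node []}"
proof -
  have "edges T = 0 \<longleftrightarrow> T = Node []" for T
    by (cases T) auto
  then show ?thesis by (auto simp: plane_trees_def)
qed

text \<open>Cutting off the last child's subtree inverts \<open>graft\<close>; the removed edge
  accounts for the \<open>Suc\<close>.\<close>

lemma plane_trees_Suc:
  "plane_trees (Suc n) = (\<lambda>(k, T, t). graft T t) ` (SIGMA k:{..n}. plane_trees k \<times> plane_trees (n - k))"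
proof (intro equalityI subsetI)
  fix U assume U: "U \<in> plane_trees (Suc n)"
  obtain us where us: "U = Node us" by (cases U)
  with U have "us \<noteq> []" by (auto simp: plane_trees_def)
  then obtain ts t where "us = ts @ [t]"
    by (metis append_butlast_last_id)
  then have U': "U = graft (Node ts) t" by (simp add: us)
  with U have "Suc (edges (Node ts) + edges t) = Suc n"
    by (simp only: plane_trees_def mem_Collect_eq edges_graft)
  then show "U \<in> (\<lambda>(k, T, t). graft T t) ` (SIGMA k:{..n}. plane_trees k \<times> plane_trees (n - k))"
    by (intro image_eqI[of _ _ "(edges (Node ts), Node ts, t)"])
       (auto simp: plane_trees_def U' simp del: edges.simps graft.simps)
qed (auto simp: plane_trees_def)

lemma sum_plane_trees_Suc:
  "(\<Sum>T\<in>plane_trees (Suc n). f T) =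
    (\<Sum>k\<le>n. \<Sum>T\<in>plane_trees k. \<Sum>t\<in>plane_trees (n - k). f (graft T t))"
proof -
  have "inj_on (\<lambda>(k, T, t). graft T t) (SIGMA k:{..n}. plane_trees k \<times> plane_trees (n - k))"
    by (auto simp: inj_on_def graft_inject plane_trees_def)
  then have "(\<Sum>T\<in>plane_trees (Suc n). f T) =
      (\<Sum>(k, T, t)\<in>(SIGMA k:{..n}. plane_trees k \<times> plane_trees (n - k)). f (graft T t))"
    unfolding plane_trees_Suc by (simp add: sum.reindex case_prod_unfold)
  also have "\<dots> = (\<Sum>k\<le>n. \<Sum>(T, t)\<in>plane_trees k \<times> plane_trees (n - k). f (graft T t))"
    by (subst sum.Sigma) auto
  finally show ?thesis
    by (simp add: sum.cartesian_product)
qed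

lemma is_leaf_plane_tree: "T \<in> plane_trees n \<Longrightarrow> is_leaf T \<longleftrightarrow> n = 0"
  by (simp add: is_leaf_iff_edges plane_trees_def)

text \<open>The value of \<open>G n\<close> at \<open>x\<close>, over any commutative semiring so
  that complex arguments are covered.\<close>

definition oleaf_sum :: "'a :: comm_semiring_1 \<Rightarrow> nat \<Rightarrow> 'a" where
  "oleaf_sum x n = (\<Sum>T\<in>plane_trees n. x ^ oleaf T)"

lemma oleaf_sum_0: "oleaf_sum x 0 = 1"
  by (simp add: oleaf_sum_def plane_trees_0)

lemma oleaf_sum_1: "oleaf_sum x (Suc 0) = x"
  by (simp add: oleaf_sum_def sum_plane_trees_Suc plane_trees_0 is_leaf_def)

text \<open>With at least two edges in all, \<open>T\<close> and \<open>t\<close> cannot both be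
  single vertices, so the weight is multiplicative.\<close>

lemma oleaf_sum_convolution:
  "oleaf_sum x (Suc (Suc n)) = (\<Sum>k\<le>Suc n. oleaf_sum x k * oleaf_sum x (Suc n - k))"
  unfolding oleaf_sum_def sum_plane_trees_Suc[of _ "Suc n"] sum_product
proof (intro sum.cong refl)
  fix k T t
  assume "T \<in> plane_trees k" "t \<in> plane_trees (Suc n - k)" "k \<in> {..Suc n}"
  then have "\<not> (is_leaf T \<and> is_leaf t)"
    by (auto simp: is_leaf_plane_tree)
  then show "x ^ oleaf (graft T t) = x ^ oleaf T * x ^ oleaf t"
    by (auto simp: oleaf_graft power_add)
qed

lemma oleaf_sum_rec:
  fixes x :: "'a :: comm_ring_1"
  shows "oleaf_sum x (Suc (Suc n)) =
    2 * oleaf_sum x (Suc n) + (\<Sum>i<n. oleaf_sum x (Suc i) * oleaf_sum x (Suc (n - 1 - i)))"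
proof -
  \<comment> \<open>The two end terms \<open>k = 0\<close> and \<open>k = Suc n\<close> contribute
    equally, whence \<open>b = 2\<close>.\<close>
  have "oleaf_sum x (Suc (Suc n)) = (\<Sum>k<n. oleaf_sum x (Suc k) * oleaf_sum x (n - k)) + 2 * oleaf_sum x (Suc n)"
    unfolding oleaf_sum_convolution
    by (subst sum.atMost_Suc_shift)
       (simp add: oleaf_sum_0 add_ac flip: lessThan_Suc_atMost)
  then show ?thesis
    by (simp add: add.commute Suc_diff_Suc)
qed

section \<open>Weighted counts of tip-augmented trees\<close>

definition tip_oleaf_sum :: "'a :: comm_semiring_1 \<Rightarrow> nat \<Rightarrow> 'a" where
  "tip_oleaf_sum x n = (\<Sum>T\<in>tip_augmented_trees n. x ^ oleaf T)"

text \<open>Giving the other trees weight 0 makes the decomposition of all plane trees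
  applicable.\<close>

lemma tip_oleaf_sum_alt:
  "tip_oleaf_sum x n = (\<Sum>T\<in>plane_trees n. if tip_augmented T then x ^ oleaf T else 0)"
  unfolding tip_oleaf_sum_def tip_augmented_trees_def by (simp add: sum.inter_filter)

lemma tip_oleaf_sum_0: "tip_oleaf_sum x 0 = 1"
  by (simp add: tip_oleaf_sum_alt plane_trees_0)

lemma tip_oleaf_sum_1: "tip_oleaf_sum x (Suc 0) = x"
  by (simp add: tip_oleaf_sum_alt sum_plane_trees_Suc plane_trees_0 is_leaf_def)

text \<open>For \<open>k = 0\<close> the subtree \<open>t\<close> would be the leftmost child of the
  root without being a leaf, so this term vanishes. Only one end term survives, whence
  \<open>b = 1\<close> in the recurrence.\<close>

lemma tip_oleaf_sum_convolution:
  "tip_oleaf_sum x (Suc (Suc n)) = (\<Sum>k\<le>n. tip_oleaf_sum x (Suc k) * tip_oleaf_sum x (n - k))"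
proof -
  let ?w = "\<lambda>T. if tip_augmented T then x ^ oleaf T else 0"
  have "tip_oleaf_sum x (Suc (Suc n)) =
      (\<Sum>k\<le>Suc n. \<Sum>T\<in>plane_trees k. \<Sum>t\<in>plane_trees (Suc n - k). if k = 0 then 0 else ?w T * ?w t)"
    unfolding tip_oleaf_sum_alt sum_plane_trees_Suc[of _ "Suc n"]
  proof (intro sum.cong refl)
    fix k T t
    assume "T \<in> plane_trees k" "t \<in> plane_trees (Suc n - k)" "k \<in> {..Suc n}"
    then show "?w (graft T t) = (if k = 0 then 0 else ?w T * ?w t)"
      by (auto simp: tip_augmented_graft oleaf_graft is_leaf_plane_tree power_add)
  qed
  also have "\<dots> = (\<Sum>k\<le>n. (\<Sum>T\<in>plane_trees (Suc k). \<Sum>t\<in>plane_trees (n - k). ?w T * ?w t))"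
    by (subst sum.atMost_Suc_shift) simp
  finally show ?thesis
    by (simp only: tip_oleaf_sum_alt sum_product)
qed

lemma tip_oleaf_sum_rec:
  fixes x :: "'a :: comm_ring_1"
  shows "tip_oleaf_sum x (Suc (Suc n)) = tip_oleaf_sum x (Suc n) +
    (\<Sum>i<n. tip_oleaf_sum x (Suc i) * tip_oleaf_sum x (Suc (n - 1 - i)))"
proof -
  have "tip_oleaf_sum x (Suc (Suc n)) =
      (\<Sum>k<n. tip_oleaf_sum x (Suc k) * tip_oleaf_sum x (n - k)) + tip_oleaf_sum x (Suc n)"
    unfolding tip_oleaf_sum_convolution
    by (simp add: tip_oleaf_sum_0 flip: lessThan_Suc_atMost)
  then show ?thesis
    by (simp add: add.commute Suc_diff_Suc)
qed

lemma poly_of_real_sum_monom: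
  "poly (map_poly of_real (\<Sum>T\<in>A. monom 1 (f T) :: real poly)) (z :: 'a :: real_field) = (\<Sum>T\<in>A. z ^ f T)"
proof -
  have "map_poly of_real (\<Sum>T\<in>A. monom 1 (f T) :: real poly) = (\<Sum>T\<in>A. monom 1 (f T) :: 'a poly)"
    by (rule poly_eqI) (simp add: coeff_map_poly coeff_sum of_real_sum if_distrib[of of_real] cong: if_cong)
  then show ?thesis
    by (simp add: poly_sum poly_monom)
qed

theorem theorem1p23:
  fixes n :: nat
  assumes "n \<ge> 1"
  shows "only_nonpos_real_zeros (G n) \<and> only_nonpos_real_zeros (M n)"
  unfolding only_nonpos_real_zeros_def
proof (intro conjI allI impI)
  fix z :: complex
  assume "poly (map_poly complex_of_real (G n)) z = 0"
  \<comment> \<open>The recurrence starts with the one-edge tree, so \<open>G n\<close> is its entry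
    number \<open>n - 1\<close>.\<close>
  then have "oleaf_sum z (Suc (n - 1)) = 0"
    using assms by (simp add: G_def poly_of_real_sum_monom oleaf_sum_def)
  then show "z \<in> \<real>\<^sub>\<le>\<^sub>0"
    using quadratic_recurrence_zero_nonpos[of "\<lambda>n. oleaf_sum z (Suc n)" z 2 "n - 1"]
    by (simp add: oleaf_sum_1 oleaf_sum_rec)
next
  fix z :: complex
  assume "poly (map_poly complex_of_real (M n)) z = 0"
  then have "tip_oleaf_sum z (Suc n) = 0"
    by (simp add: M_def poly_of_real_sum_monom tip_oleaf_sum_def)
  then show "z \<in> \<real>\<^sub>\<le>\<^sub>0"
    using quadratic_recurrence_zero_nonpos[of "\<lambda>n. tip_oleaf_sum z (Suc n)" z 1 n]
    by (simp add: tip_oleaf_sum_1 tip_oleaf_sum_rec)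
qed

end
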